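(* Let $G$ be a finite simple connected graph such that $D(G)\neq 1$ and $\chi_D(G)=2$. Then $|\mathrm{Aut}(G)|=2$.
   Context: $\mathrm{Aut}(G)$ is the automorphism group of $G$. A vertex coloring $h:V(G)\to\{1,\dots,r\}$ is distinguishing if the only automorphism $\psi$ of $G$ with $h(\psi(v))=h(v)$ for all $v\in V(G)$ is the identity. The distinguishing number $D(G)$ is the least $r$ such that $G$ has a distinguishing vertex coloring with colors $\{1,\dots,r\}$ (not necessarily proper). The distinguishing chromatic number $\chi_D(G)$ is the least $r$ such that $G$ has a vertex coloring with colors $\{1,\dots,r\}$ that is both proper and distinguishing. *)

theory Defs
  imports "Graph_Theory.Digraph_Component" "HOL-Combinatorics.Permutations" "HOL-Library.FuncSet"
begin

text \<open>
  A finite simple graph is a symmetric, loop-free digraph without parallel arcs (locale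
  \<^locale>\<open>graph\<close>), where an undirected edge is a pair of opposite arcs. In such a graph
  an automorphism is determined by its action on the vertices. It is represented by a function
  that is the identity outside \<^term>\<open>verts G\<close>, so that distinct automorphisms are distinct
  functions and the set of automorphisms has the intended cardinality.
\<close>

definition Aut :: "('a, 'b) pre_digraph \<Rightarrow> ('a \<Rightarrow> 'a) set" where
  "Aut G = {\<psi>. \<psi> permutes verts G \<and>
     (\<forall>u \<in> verts G. \<forall>v \<in> verts G. (\<psi> u \<rightarrow>\<^bsub>G\<^esub> \<psi> v) \<longleftrightarrow> (u \<rightarrow>\<^bsub>G\<^esub> v))}"

definition vertex_coloring :: "('a, 'b) pre_digraph \<Rightarrow> nat \<Rightarrow> ('a \<Rightarrow> nat) \<Rightarrow> bool" where
  "vertex_coloring G r h \<longleftrightarrow> h \<in> verts G \<rightarrow> {1..r}"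

definition proper_coloring :: "('a, 'b) pre_digraph \<Rightarrow> ('a \<Rightarrow> nat) \<Rightarrow> bool" where
  "proper_coloring G h \<longleftrightarrow> (\<forall>u v. (u \<rightarrow>\<^bsub>G\<^esub> v) \<longrightarrow> h u \<noteq> h v)"

definition distinguishing :: "('a, 'b) pre_digraph \<Rightarrow> ('a \<Rightarrow> nat) \<Rightarrow> bool" where
  "distinguishing G h \<longleftrightarrow> (\<forall>\<psi> \<in> Aut G. (\<forall>v \<in> verts G. h (\<psi> v) = h v) \<longrightarrow> \<psi> = id)"

text \<open>
  For a finite loop-free graph both minima below range over nonempty sets of numbers, since an
  injective coloring is proper and distinguishing.
\<close>

definition distinguishing_number :: "('a, 'b) pre_digraph \<Rightarrow> nat" where
  "distinguishing_number G = (LEAST r. \<exists>h. vertex_coloring G r h \<and> distinguishing G h)"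

definition distinguishing_chromatic_number :: "('a, 'b) pre_digraph \<Rightarrow> nat" where
  "distinguishing_chromatic_number G =
     (LEAST r. \<exists>h. vertex_coloring G r h \<and> proper_coloring G h \<and> distinguishing G h)"

end

theory Submission
  imports Defs
begin

text \<open>
  In a connected graph any two proper colorings with the same two colors coincide or are
  exchanged by swapping the colors. Hence an automorphism either preserves or everywhere swaps the
  classes of a given proper distinguishing 2-coloring. Only the identity preserves them, and the
  composition of two swapping automorphisms is preserving, so there is at most one swapping
  automorphism.
\<close>

lemma id_in_Aut: "id \<in> Aut G"
  by (simp add: Aut_def permutes_id)

lemma comp_in_Aut:
  assumes "\<phi> \<in> Aut G" "\<psi> \<in> Aut G"
  shows "\<phi> \<circ> \<psi> \<in> Aut G"
  using assms by (auto simp: Aut_def permutes_compose permutes_in_image)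

lemma Aut_in_verts: "\<psi> \<in> Aut G \<Longrightarrow> v \<in> verts G \<Longrightarrow> \<psi> v \<in> verts G"
  by (simp add: Aut_def permutes_in_image)

text \<open>A constant coloring is distinguishing here, and a vertex excludes \<open>r = 0\<close>
  because \<open>{1..0}\<close> is empty. The contrapositive turns
  \<open>distinguishing_number G \<noteq> 1\<close> into a nonidentity automorphism.\<close>

lemma distinguishing_number_trivial_Aut:
  assumes "verts G \<noteq> {}" "Aut G \<subseteq> {id}"
  shows "distinguishing_number G = 1"
  unfolding distinguishing_number_def
proof (rule Least_equality)
  show "\<exists>h. vertex_coloring G 1 h \<and> distinguishing G h"
    using assms(2) by (intro exI[of _ "\<lambda>_. 1"]) (auto simp: vertex_coloring_def distinguishing_def)
next
  fix r assume "\<exists>h. vertex_coloring G r h \<and> distinguishing G h"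
  then obtain h v where "h v \<in> {1..r}"
    using assms(1) unfolding vertex_coloring_def by blast
  then show "1 \<le> r" by simp
qed

lemma distinguishing_if_inj_on:
  assumes "inj_on h (verts G)"
  shows "distinguishing G h"
  unfolding distinguishing_def
proof (intro ballI impI)
  fix \<psi> assume \<psi>: "\<psi> \<in> Aut G" and h: "\<forall>v \<in> verts G. h (\<psi> v) = h v"
  have "\<psi> v = v" for v
  proof (cases "v \<in> verts G")
    case True
    then show ?thesis using h inj_onD[OF assms] Aut_in_verts[OF \<psi>] by blast
  next
    case False
    then show ?thesis using \<psi> by (auto simp: Aut_def permutes_def)
  qed
  then show "\<psi> = id" by auto
qed

text \<open>The value of a \<open>LEAST\<close> yields a witness only if some number qualifies.
  Numbering the vertices injectively provides one: it is proper since there are no loops, and only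
  the identity preserves it.\<close>

lemma (in fin_digraph) distinguishing_chromatic_number_attained:
  assumes "loopfree_digraph G"
  obtains h where "vertex_coloring G (distinguishing_chromatic_number G) h"
    "proper_coloring G h" "distinguishing G h"
proof -
  interpret loopfree_digraph G by fact
  obtain h where h: "bij_betw h (verts G) {1..card (verts G)}"
    using ex_bij_betw_finite_nat[OF finite_verts]
      finite_same_card_bij[of "verts G" "{1..card (verts G)}"] by auto
  have "vertex_coloring G (card (verts G)) h"
    using bij_betwE[OF h] by (simp add: vertex_coloring_def)
  moreover have "proper_coloring G h"
    unfolding proper_coloring_def
  proof (intro allI impI)
    fix u v assume "u \<rightarrow>\<^bsub>G\<^esub> v"
    then have "u \<in> verts G" "v \<in> verts G" "u \<noteq> v"
      using adj_in_verts adj_not_same by blast+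
    then show "h u \<noteq> h v"
      using bij_betw_imp_inj_on[OF h] by (simp add: inj_on_eq_iff)
  qed
  moreover have "distinguishing G h"
    using h by (simp add: bij_betw_def distinguishing_if_inj_on)
  ultimately have "\<exists>r h. vertex_coloring G r h \<and> proper_coloring G h \<and> distinguishing G h"
    by blast
  from LeastI_ex[OF this] show thesis
    using that unfolding distinguishing_chromatic_number_def by blast
qed

text \<open>Across an arc both colorings must change color, and with two colors the new one is
  forced by the old. So agreement and disagreement both propagate along walks.\<close>

lemma (in wf_digraph) two_colorings_agree_iff:
  assumes "vertex_coloring G 2 g" "proper_coloring G g"
    and "vertex_coloring G 2 h" "proper_coloring G h"
    and "u \<rightarrow>\<^sup>*\<^bsub>G\<^esub> v"
  shows "g u = h u \<longleftrightarrow> g v = h v"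
  using assms(5)
proof (induction rule: reachable_induct)
  case base
  show ?case by simp
next
  case (step v w)
  have "g v \<in> {1..2}" "g w \<in> {1..2}" "h v \<in> {1..2}" "h w \<in> {1..2}"
    using assms(1,3) adj_in_verts[OF step(2)] by (auto simp: vertex_coloring_def)
  moreover have "g v \<noteq> g w" "h v \<noteq> h w"
    using assms(2,4) step(2) by (auto simp: proper_coloring_def)
  ultimately have "g v = h v \<longleftrightarrow> g w = h w" by auto
  with step show ?case by simp
qed

lemma vertex_coloring_comp_Aut:
  assumes "\<psi> \<in> Aut G" "vertex_coloring G r h"
  shows "vertex_coloring G r (h \<circ> \<psi>)"
  using assms Aut_in_verts[OF assms(1)] by (auto simp: vertex_coloring_def Pi_iff)

lemma (in wf_digraph) proper_coloring_comp_Aut: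
  assumes "\<psi> \<in> Aut G" "proper_coloring G h"
  shows "proper_coloring G (h \<circ> \<psi>)"
  unfolding proper_coloring_def
proof (intro allI impI)
  fix u v assume uv: "u \<rightarrow>\<^bsub>G\<^esub> v"
  then have "\<psi> u \<rightarrow>\<^bsub>G\<^esub> \<psi> v"
    using assms(1) adj_in_verts[OF uv] by (simp add: Aut_def)
  then show "(h \<circ> \<psi>) u \<noteq> (h \<circ> \<psi>) v"
    using assms(2) by (simp add: proper_coloring_def)
qed

theorem theorem4p5:
  fixes G :: "('a, 'b) pre_digraph"
  assumes "graph G"
    and "Digraph_Component.connected G"
    and "distinguishing_number G \<noteq> 1"
    and "distinguishing_chromatic_number G = 2"
  shows "card (Aut G) = 2"
proof -
  interpret graph G by fact
  \<comment> \<open>Arcs come in opposite pairs, so connectedness gives a directed walk between any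
    two vertices, as the propagation of agreement requires.\<close>
  have sc: "strongly_connected G"
    using assms(2) by (simp add: symmetric_connected_imp_strongly_connected sym_arcs)
  then have ne: "verts G \<noteq> {}" by (simp add: strongly_connected_def)
  obtain h where col: "vertex_coloring G 2 h" and proper: "proper_coloring G h"
    and dist: "distinguishing G h"
    using distinguishing_chromatic_number_attained[OF loopfree_digraph_axioms]
    unfolding assms(4) by blast
  \<comment> \<open>The map \<open>c \<mapsto> 3 - c\<close> exchanges the colors 1 and 2.\<close>
  have swap: "h (\<psi> v) = 3 - h v" if \<psi>: "\<psi> \<in> Aut G" "\<psi> \<noteq> id" and v: "v \<in> verts G" for \<psi> v
  proof -
    obtain u where u: "u \<in> verts G" "h (\<psi> u) \<noteq> h u"
      using dist \<psi> unfolding distinguishing_def by blast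
    have "u \<rightarrow>\<^sup>*\<^bsub>G\<^esub> v" using sc u v by (simp add: strongly_connected_def)
    \<comment> \<open>The colorings compared are \<open>h \<circ> \<psi>\<close> and
      \<open>h\<close>; their disagreement at \<open>u\<close> carries over to
      \<open>v\<close>.\<close>
    from two_colorings_agree_iff[OF vertex_coloring_comp_Aut[OF \<psi>(1) col]
        proper_coloring_comp_Aut[OF \<psi>(1) proper] col proper this] u
    have "h (\<psi> v) \<noteq> h v" by simp
    moreover have "h (\<psi> v) \<in> {1..2}" "h v \<in> {1..2}"
      using col v Aut_in_verts[OF \<psi>(1) v] by (auto simp: vertex_coloring_def)
    ultimately show ?thesis by auto
  qed
  have comp: "\<phi> \<circ> \<psi> = id" if "\<phi> \<in> Aut G" "\<phi> \<noteq> id" "\<psi> \<in> Aut G" "\<psi> \<noteq> id" for \<phi> \<psi>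
  proof -
    have "h ((\<phi> \<circ> \<psi>) v) = h v" if v: "v \<in> verts G" for v
    proof -
      \<comment> \<open>The bound ensures \<open>3 - (3 - h v) = h v\<close> despite truncated
        subtraction on \<open>nat\<close>.\<close>
      have "h v \<in> {1..2}" using col v by (auto simp: vertex_coloring_def)
      then show ?thesis
        using swap[OF \<open>\<psi> \<in> Aut G\<close> \<open>\<psi> \<noteq> id\<close> v]
          swap[OF \<open>\<phi> \<in> Aut G\<close> \<open>\<phi> \<noteq> id\<close> Aut_in_verts[OF \<open>\<psi> \<in> Aut G\<close> v]] by auto
    qed
    then show ?thesis
      using dist comp_in_Aut[OF that(1,3)] unfolding distinguishing_def by blast
  qed
  obtain \<phi> where \<phi>: "\<phi> \<in> Aut G" "\<phi> \<noteq> id"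
    using distinguishing_number_trivial_Aut[OF ne] assms(3) by blast
  have "\<psi> = \<phi>" if "\<psi> \<in> Aut G" "\<psi> \<noteq> id" for \<psi>
  proof -
    \<comment> \<open>By \<open>comp\<close>, both \<open>\<phi> \<circ> \<phi>\<close> and
      \<open>\<phi> \<circ> \<psi>\<close> are the identity; regrouping the triple product
      identifies \<open>\<psi>\<close> with \<open>\<phi>\<close>.\<close>
    have "\<psi> = (\<phi> \<circ> \<phi>) \<circ> \<psi>" using comp[OF \<phi> \<phi>] by simp
    also have "\<dots> = \<phi>" using comp[OF \<phi> that] by (simp add: comp_assoc)
    finally show ?thesis .
  qed
  then have "Aut G = {id, \<phi>}"
    using \<phi>(1) id_in_Aut by blast
  then show ?thesis
    using \<phi>(2) by simp
qed

end
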